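(* Let $f_c(z)=e^z+c$ be such that $c\in J(f_c)$ and $c$ is non-recurrent, i.e. $c\notin\mathcal{P}(f_c)$. Then $\mathcal{P}(f_c)$ is hyperbolic with respect to the Euclidean metric, i.e. there exist $\bar k$ and $\eta>1$ such that $|(f_c^k)'(z)|>\eta$ for every integer $k>\bar k$ and every $z\in\mathcal{P}(f_c)$.
   Context: $J(f_c)$ is the Julia set of $f_c$. The postsingular set is $\mathcal{P}(f_c)=\overline{\bigcup_{n>0}\{f_c^n(c)\}}$ (the orbit starts at $f_c(c)$, so $c$ itself is not automatically included). It may be unbounded. *)

theory Defs
  imports "HOL-Complex_Analysis.Complex_Analysis"
begin

definition exp_map :: "complex \<Rightarrow> complex \<Rightarrow> complex" where
  "exp_map c = (\<lambda>z. exp z + c)"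

text \<open>
  Normality in the sense of Montel, for families of holomorphic functions on a domain \<open>U\<close>:
  on a connected open set, the limit functions with respect to the spherical metric are the
  holomorphic functions and the constant infinity. Locally uniform convergence is expressed
  as uniform convergence on compact subsets.
\<close>

definition locally_uniformly_to_infinity ::
    "complex set \<Rightarrow> (nat \<Rightarrow> complex \<Rightarrow> complex) \<Rightarrow> bool" where
  "locally_uniformly_to_infinity U s \<longleftrightarrow>
     (\<forall>K. compact K \<and> K \<subseteq> U \<longrightarrow>
        (\<forall>B::real. \<forall>\<^sub>F n in sequentially. \<forall>z\<in>K. norm (s n z) > B))"

definition normal_family_on :: "complex set \<Rightarrow> (complex \<Rightarrow> complex) set \<Rightarrow> bool" where
  "normal_family_on U F \<longleftrightarrow>
     (\<forall>s::nat \<Rightarrow> complex \<Rightarrow> complex. range s \<subseteq> F \<longrightarrow>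
        (\<exists>r::nat \<Rightarrow> nat. strict_mono r \<and>
           ((\<exists>g. g holomorphic_on U \<and>
               (\<forall>K. compact K \<and> K \<subseteq> U \<longrightarrow> uniform_limit K (s \<circ> r) g sequentially)) \<or>
            locally_uniformly_to_infinity U (s \<circ> r))))"

definition fatou_set :: "(complex \<Rightarrow> complex) \<Rightarrow> complex set" where
  "fatou_set f =
     {z. \<exists>U. open U \<and> connected U \<and> z \<in> U \<and> normal_family_on U (range (\<lambda>n. f ^^ n))}"

definition julia_set :: "(complex \<Rightarrow> complex) \<Rightarrow> complex set" where
  "julia_set f = - fatou_set f"

text \<open>
  The only singular value of \<open>exp_map c\<close> is the asymptotic value \<open>c\<close>. The orbit is taken from
  its first iterate on, so \<open>c\<close> belongs to this set only if it is periodic or an accumulation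
  point of its own orbit.
\<close>

definition postsingular_set :: "complex \<Rightarrow> complex set" where
  "postsingular_set c = closure (\<Union>n\<in>{0<..}. {(exp_map c ^^ n) c})"

definition euclidean_hyperbolic_on :: "(complex \<Rightarrow> complex) \<Rightarrow> complex set \<Rightarrow> bool" where
  "euclidean_hyperbolic_on f X \<longleftrightarrow>
     (\<exists>(kbar::nat) (\<eta>::real). \<eta> > 1 \<and> (\<forall>k>kbar. \<forall>z\<in>X. norm (deriv (f ^^ k) z) > \<eta>))"

end

theory Submission
  imports Defs
begin

text \<open>
  Write \<open>f\<close> for the map, \<open>P\<close> for the postsingular set, \<open>\<delta> > 0\<close> for the distance from \<open>c\<close> to \<open>P\<close>.
  Everything is deduced from one source of normality: if all iterates of \<open>f\<close> are injective on a
  fixed disc about \<open>z\<close>, then no image of that disc contains a disc of radius greater than \<open>\<pi>\<close>,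
  because \<open>f\<close> has period \<open>2\<pi>\<i>\<close> and is injective there. By Koebe-type distortion the images of the
  half-size disc have bounded diameter, and Montel's theorem puts \<open>z\<close> into the Fatou set
  (\<open>fatou_set_if_iterates_inj_on\<close>). Since \<open>c\<close> is in the Julia set, no disc about \<open>c\<close> has
  all iterates injective on it.

  The heart of the proof is a uniform radius \<open>\<rho>\<close> such that for every \<open>z \<in> P\<close> and every \<open>m\<close> the
  inverse branch of \<open>f^m\<close> sending \<open>f^m z\<close> to \<open>z\<close> exists on the whole disc of radius \<open>\<rho>\<close> about
  \<open>f^m z\<close> (\<open>no_pullback_meets_singular_value\<close>). A branch can be lifted by one more step as long as
  its image omits the only singular value \<open>c\<close>. Suppose that for a given \<open>\<rho> \<le> \<delta>\<close> some pullback hits \<open>c\<close>,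
  and take the smallest such \<open>m\<close>, with a point \<open>z \<in> P\<close> and a branch \<open>\<phi>\<close> about \<open>w = f^m z\<close>. Then
  \<open>v = f^m c\<close> lies within \<open>\<rho>\<close> of \<open>w\<close>. As \<open>f c \<in> P\<close>, minimality of \<open>m\<close> also gives a branch
  \<open>\<psi>\<close> of \<open>f^m\<close> about \<open>v\<close> that leads back to \<open>c\<close> and is defined on the disc of the \<^emph>\<open>same\<close> radius.
  The two branches agree where both are defined, and distortion along the segment from \<open>v\<close> to \<open>w\<close>
  bounds \<open>\<delta> \<le> |z - c|\<close> by a constant times \<open>\<rho> |\<psi>' v|\<close>. So the image of \<open>\<psi>\<close> contains a disc
  about \<open>c\<close> whose radius depends on \<open>\<delta>\<close> only, and \<open>f^m\<close> is injective on it; as \<open>c\<close> is in the Julia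
  set, \<open>m\<close> is bounded independently of \<open>\<rho>\<close>. But for bounded \<open>m\<close> the derivative
  \<open>|\<psi>' v| = 1 / |(f^m)' c|\<close> is bounded, and the inequality fails for small \<open>\<rho>\<close>.

  If now \<open>|(f^k)' z| \<le> 2\<close> for arbitrarily large \<open>k\<close> and points \<open>z \<in> P\<close> depending on \<open>k\<close>, the branches on the discs of radius
  \<open>\<rho>\<close> show that \<open>f^k\<close> is injective on a disc of fixed size about \<open>z\<close>. The points \<open>f z\<close> then stay in
  a bounded part of \<open>P\<close> and accumulate at a point of \<open>P\<close> near which all iterates are injective. Some
  \<open>f^N c\<close> lies in that neighbourhood, so all iterates are injective near \<open>c\<close>, which is impossible.
\<close>

section \<open>Distortion of injective holomorphic functions\<close>

lemma norm_deriv_le_of_bounded: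
  assumes "f holomorphic_on ball x s" and "0 < s"
    and bound: "\<And>y. y \<in> ball x s \<Longrightarrow> norm (f y - a) \<le> B"
  shows "norm (deriv f x) \<le> 2 * B / s"
proof -
  let ?h = "\<lambda>y. f y - a"
  have hol: "?h holomorphic_on ball x s"
    using assms(1) by (intro holomorphic_intros)
  have sub: "cball x (s/2) \<subseteq> ball x s"
    using \<open>0 < s\<close> by auto
  have "norm ((deriv ^^ 1) ?h x) \<le> fact 1 * B / (s/2)^1"
  proof (rule Cauchy_inequality)
    show "?h holomorphic_on ball x (s/2)"
      using hol sub by (meson ball_subset_cball holomorphic_on_subset)
    show "continuous_on (cball x (s/2)) ?h"
      using hol sub holomorphic_on_imp_continuous_on holomorphic_on_subset by blast
    show "norm (?h y) \<le> B" if "norm (x - y) = s/2" for y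
      using bound that \<open>0 < s\<close> by (simp add: dist_norm)
  qed (use \<open>0 < s\<close> in simp)
  moreover have "deriv ?h x = deriv f x"
  proof -
    have "f field_differentiable at x"
      using assms(1,2) holomorphic_on_imp_differentiable_at[of f "ball x s" x] by simp
    then show ?thesis by simp
  qed
  ultimately show ?thesis by (simp add: mult.commute)
qed

text \<open>
  The square-root trick behind Koebe's theorem, with Schottky's theorem in place of the area
  theorem. If \<open>g\<close> is injective and omits \<open>a\<close>, a square root \<open>q\<close> of \<open>(g - a) / (g x - a)\<close> exists and
  never takes two opposite values. Normalised by \<open>q x = -1\<close> it omits both \<open>0\<close> and \<open>1\<close>, so it is
  bounded by an absolute constant on smaller discs.
\<close>

lemma omitted_value_growth:
  "\<exists>K\<ge>1. \<forall>g x s a y. 0 < s \<longrightarrow> g holomorphic_on ball x s \<longrightarrow> inj_on g (ball x s) \<longrightarrow>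
      a \<notin> g ` ball x s \<longrightarrow> norm (y - x) \<le> 3/4 * s \<longrightarrow> norm (g y - a) \<le> K * norm (g x - a)"
proof -
  define S where "S = exp (pi * exp (pi * (2 + 2 * 1 + 12 * (6/7) / (1 - 6/7))))"
  have "1 \<le> S" unfolding S_def by simp
  have "norm (g y - a) \<le> S\<^sup>2 * norm (g x - a)"
    if "0 < s" and hol: "g holomorphic_on ball x s" and inj: "inj_on g (ball x s)"
      and omit: "a \<notin> g ` ball x s" and y: "norm (y - x) \<le> 3/4 * s"
    for g :: "complex \<Rightarrow> complex" and x y a :: complex and s :: real
  proof -
    have gx: "g x - a \<noteq> 0" using omit \<open>0 < s\<close> by auto
    obtain q0 where q0: "q0 holomorphic_on ball x s"
      "\<And>z. z \<in> ball x s \<Longrightarrow> (g z - a) / (g x - a) = q0 z ^ 2"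
    proof (rule contractible_imp_holomorphic_sqrt)
      show "(\<lambda>z. (g z - a) / (g x - a)) holomorphic_on ball x s"
        using gx by (intro holomorphic_intros hol) auto
    qed (use omit gx in \<open>auto simp: convex_imp_contractible\<close>)
    have q0x: "(q0 x)\<^sup>2 = 1" using q0(2)[of x] gx \<open>0 < s\<close> by simp
    \<comment> \<open>The factor \<open>- q0 x\<close> is \<open>1\<close> or \<open>-1\<close> and only selects the root with value \<open>-1\<close> at \<open>x\<close>.\<close>
    define q where "q = (\<lambda>z. - q0 x * q0 z)"
    have q: "q holomorphic_on ball x s"
      "\<And>z. z \<in> ball x s \<Longrightarrow> (g z - a) / (g x - a) = q z ^ 2"
      unfolding q_def using q0 q0x by (auto intro!: holomorphic_intros simp: power_mult_distrib)
    have qx: "q x = -1" using q0x by (simp add: q_def power2_eq_square)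
    have q_omits: "q z \<noteq> 0 \<and> q z \<noteq> 1" if z: "z \<in> ball x s" for z
    proof
      show "q z \<noteq> 0" using q(2)[OF z] omit z gx by auto
      show "q z \<noteq> 1"
      proof
        assume "q z = 1"
        then have "g z = g x" using q(2)[OF z] gx by simp
        then have "z = x" using inj z \<open>0 < s\<close> by (simp add: inj_on_eq_iff)
        then show False using \<open>q z = 1\<close> qx by simp
      qed
    qed
    \<comment> \<open>Schottky's theorem needs a closed disc inside the ball; radius \<open>7/8 s\<close> leaves \<open>3/4 s = 6/7 t\<close>.\<close>
    define t where "t = 7/8 * s"
    have "0 < t" using \<open>0 < s\<close> by (simp add: t_def)
    have in_ball: "x + of_real t * w \<in> ball x s" if "w \<in> cball 0 1" for w
    proof -
      have "t * norm w \<le> t * 1" using that \<open>0 < t\<close> by (intro mult_left_mono) auto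
      then show ?thesis using \<open>0 < t\<close> \<open>0 < s\<close> by (simp add: dist_norm norm_mult t_def)
    qed
    have "norm ((\<lambda>w. q (x + of_real t * w)) ((y - x) / of_real t)) \<le> S"
      unfolding S_def
    proof (rule Schottky[where f = "\<lambda>w. q (x + of_real t * w)"])
      show "(\<lambda>w. q (x + of_real t * w)) holomorphic_on cball 0 1"
        using in_ball by (intro holomorphic_on_compose_gen[OF _ q(1), unfolded o_def] holomorphic_intros) auto
      show "norm ((y - x) / of_real t) \<le> 6/7"
      proof -
        have "norm ((y - x) / of_real t) = norm (y - x) / t" using \<open>0 < t\<close> by (simp add: norm_divide)
        also have "\<dots> \<le> 6/7" using y \<open>0 < s\<close> by (simp add: pos_divide_le_eq t_def)
        finally show ?thesis .
      qed
    qed (use qx q_omits in_ball in auto)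
    then have "norm (q y) \<le> S" using \<open>0 < t\<close> by simp
    then have "norm (q y)^2 \<le> S\<^sup>2" by (intro power_mono) auto
    moreover have "y \<in> ball x s" using y \<open>0 < s\<close> by (simp add: dist_norm norm_minus_commute)
    ultimately have "norm ((g y - a) / (g x - a)) \<le> S\<^sup>2"
      using q(2) by (simp add: norm_power)
    then show ?thesis using gx by (simp add: norm_divide field_simps)
  qed
  moreover have "1 \<le> S\<^sup>2" using \<open>1 \<le> S\<close> by simp
  ultimately show ?thesis by blast
qed

text \<open>
  Cauchy's estimate for the inverse function: an image that contains a larger disc about \<open>g x\<close>
  would make the derivative of the inverse too small.
\<close>

lemma omitted_value_nearby:
  assumes "0 < s" and hol: "g holomorphic_on ball x s" and inj: "inj_on g (ball x s)"
  shows "\<exists>a. a \<notin> g ` ball x s \<and> norm (a - g x) \<le> 4 * s * norm (deriv g x)"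
proof (rule ccontr)
  assume none: "\<not> ?thesis"
  have nz: "deriv g x \<noteq> 0"
    using holomorphic_injective_imp_regular[OF hol _ inj] \<open>0 < s\<close> by simp
  define R where "R = 4 * s * norm (deriv g x)"
  have "0 < R" using nz \<open>0 < s\<close> by (simp add: R_def)
  have cover: "ball (g x) R \<subseteq> g ` ball x s"
    using none by (force simp: R_def dist_norm norm_minus_commute)
  obtain h where h: "h holomorphic_on g ` ball x s"
    "\<And>z. z \<in> ball x s \<Longrightarrow> deriv g z * deriv h (g z) = 1"
    "\<And>z. z \<in> ball x s \<Longrightarrow> h (g z) = z"
    using holomorphic_has_inverse[OF hol _ inj] by auto
  have "norm (deriv h (g x)) \<le> 2 * s / R"
  proof (rule norm_deriv_le_of_bounded)
    show "h holomorphic_on ball (g x) R" using h(1) cover holomorphic_on_subset by blast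
    show "norm (h y - x) \<le> s" if "y \<in> ball (g x) R" for y
      using that cover h(3) by (force simp: dist_norm norm_minus_commute)
  qed fact
  also have "\<dots> = 1 / (2 * norm (deriv g x))" using \<open>0 < s\<close> by (simp add: R_def)
  finally have "norm (deriv g x) * norm (deriv h (g x)) \<le> norm (deriv g x) * (1 / (2 * norm (deriv g x)))"
    by (intro mult_left_mono) auto
  moreover have "norm (deriv g x) * norm (deriv h (g x)) = 1"
    using h(2)[of x] \<open>0 < s\<close> by (simp flip: norm_mult)
  ultimately show False using nz by simp
qed

text \<open>
  Koebe's covering, growth and distortion theorems with one non-sharp constant. Covering follows from the
  growth of \<open>g - a\<close> for an arbitrary omitted \<open>a\<close>, growth and distortion from that for an
  omitted \<open>a\<close> close to \<open>g x\<close>.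
\<close>

lemma weak_koebe:
  "\<exists>M\<ge>1. \<forall>g x s. 0 < s \<longrightarrow> g holomorphic_on ball x s \<longrightarrow> inj_on g (ball x s) \<longrightarrow>
      ball (g x) (s * norm (deriv g x) / M) \<subseteq> g ` ball x s \<and>
      (\<forall>y. norm (y - x) \<le> s / 2 \<longrightarrow>
         norm (g y - g x) \<le> M * s * norm (deriv g x) \<and> norm (deriv g y) \<le> M * norm (deriv g x))"
proof -
  obtain K where "1 \<le> K" and K: "\<And>g x s a y. \<lbrakk>0 < s; g holomorphic_on ball x s;
      inj_on g (ball x s); a \<notin> g ` ball x s; norm (y - x) \<le> 3/4 * s\<rbrakk>
      \<Longrightarrow> norm (g y - a) \<le> K * norm (g x - a)"
    using omitted_value_growth by metis
  define M where "M = 64 * K"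
  have "ball (g x) (s * norm (deriv g x) / M) \<subseteq> g ` ball x s \<and>
      (\<forall>y. norm (y - x) \<le> s / 2 \<longrightarrow>
         norm (g y - g x) \<le> M * s * norm (deriv g x) \<and> norm (deriv g y) \<le> M * norm (deriv g x))"
    if "0 < s" and hol: "g holomorphic_on ball x s" and inj: "inj_on g (ball x s)" for g x s
  proof (intro conjI allI impI)
    show "ball (g x) (s * norm (deriv g x) / M) \<subseteq> g ` ball x s"
    proof
      fix a assume a: "a \<in> ball (g x) (s * norm (deriv g x) / M)"
      show "a \<in> g ` ball x s"
      proof (rule ccontr)
        assume omit: "a \<notin> g ` ball x s"
        have "norm (deriv g x) \<le> 2 * (K * norm (g x - a)) / (3/4 * s)"
          by (rule norm_deriv_le_of_bounded[where a = a])
            (use K[OF \<open>0 < s\<close> hol inj omit] hol \<open>0 < s\<close> in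
              \<open>auto simp: dist_norm norm_minus_commute intro: holomorphic_on_subset\<close>)
        then have "s * norm (deriv g x) * 3 \<le> 8 * K * norm (g x - a)"
          using \<open>0 < s\<close> by (simp add: field_simps)
        moreover have "M * norm (g x - a) < s * norm (deriv g x)"
          using a \<open>1 \<le> K\<close> by (simp add: dist_norm M_def field_simps)
        moreover have "0 \<le> K * norm (g x - a)" using \<open>1 \<le> K\<close> by simp
        ultimately show False unfolding M_def by linarith
      qed
    qed
    obtain a where a: "a \<notin> g ` ball x s" "norm (a - g x) \<le> 4 * s * norm (deriv g x)"
      using omitted_value_nearby[OF \<open>0 < s\<close> hol inj] by blast
    define D where "D = s * norm (deriv g x)"
    have "0 \<le> D" using \<open>0 < s\<close> by (simp add: D_def)
    have near: "norm (g y - a) \<le> 4 * K * D" if "norm (y - x) \<le> 3/4 * s" for y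
    proof -
      have "norm (g y - a) \<le> K * norm (g x - a)" by (rule K) fact+
      also have "\<dots> \<le> K * (4 * s * norm (deriv g x))"
        using a(2) \<open>1 \<le> K\<close> by (intro mult_left_mono) (auto simp: norm_minus_commute)
      finally show ?thesis by (simp add: D_def mult_ac)
    qed
    fix y assume y: "norm (y - x) \<le> s / 2"
    have "norm (g y - g x) \<le> norm (g y - a) + norm (g x - a)"
      by (metis norm_triangle_ineq4 diff_diff_eq2 diff_add_cancel add_diff_cancel)
    also have "\<dots> \<le> 4 * K * D + 4 * K * D"
      using y \<open>0 < s\<close> by (intro add_mono near) auto
    also have "\<dots> \<le> M * D" unfolding M_def using \<open>0 \<le> D\<close> \<open>1 \<le> K\<close> by (simp add: mult_nonneg_nonneg)
    finally show "norm (g y - g x) \<le> M * s * norm (deriv g x)" by (simp add: D_def mult_ac)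
    have sub: "norm (z - x) < 3/4 * s" if "z \<in> ball y (s/4)" for z
    proof -
      have "norm (z - x) \<le> norm (z - y) + norm (y - x)"
        using norm_triangle_ineq[of "z - y" "y - x"] by simp
      then show ?thesis using that y by (simp add: dist_norm norm_minus_commute)
    qed
    have "norm (deriv g y) \<le> 2 * (4 * K * D) / (s/4)"
    proof (rule norm_deriv_le_of_bounded)
      show "g holomorphic_on ball y (s/4)"
      proof (rule holomorphic_on_subset[OF hol])
        show "ball y (s/4) \<subseteq> ball x s"
        proof
          fix z assume "z \<in> ball y (s/4)"
          from sub[OF this] show "z \<in> ball x s"
            using \<open>0 < s\<close> by (simp add: dist_norm norm_minus_commute)
        qed
      qed
      show "norm (g z - a) \<le> 4 * K * D" if "z \<in> ball y (s/4)" for z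
        using sub[OF that] by (intro near) simp
    qed (use \<open>0 < s\<close> in simp)
    also have "\<dots> \<le> M * norm (deriv g x)"
      using \<open>0 < s\<close> \<open>1 \<le> K\<close> by (simp add: D_def M_def field_simps)
    finally show "norm (deriv g y) \<le> M * norm (deriv g x)" .
  qed
  moreover have "1 \<le> M" using \<open>1 \<le> K\<close> by (simp add: M_def)
  ultimately show ?thesis by blast
qed

text \<open>
  Any constant that serves in \<open>weak_koebe\<close> will do; its value never enters.
\<close>

definition koebe_const :: real where
  "koebe_const = (SOME M. 1 \<le> M \<and> (\<forall>g x s. 0 < s \<longrightarrow> g holomorphic_on ball x s \<longrightarrow>
      inj_on g (ball x s) \<longrightarrow>
      ball (g x) (s * norm (deriv g x) / M) \<subseteq> g ` ball x s \<and>
      (\<forall>y. norm (y - x) \<le> s / 2 \<longrightarrow>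
         norm (g y - g x) \<le> M * s * norm (deriv g x) \<and> norm (deriv g y) \<le> M * norm (deriv g x))))"

lemma koebe_const_ge_1: "1 \<le> koebe_const"
  and koebe_covering: "\<lbrakk>0 < s; g holomorphic_on ball x s; inj_on g (ball x s)\<rbrakk>
      \<Longrightarrow> ball (g x) (s * norm (deriv g x) / koebe_const) \<subseteq> g ` ball x s"
  and koebe_growth: "\<lbrakk>0 < s; g holomorphic_on ball x s; inj_on g (ball x s); norm (y - x) \<le> s / 2\<rbrakk>
      \<Longrightarrow> norm (g y - g x) \<le> koebe_const * s * norm (deriv g x)"
  and koebe_distortion: "\<lbrakk>0 < s; g holomorphic_on ball x s; inj_on g (ball x s); norm (y - x) \<le> s / 2\<rbrakk>
      \<Longrightarrow> norm (deriv g y) \<le> koebe_const * norm (deriv g x)"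
  using someI_ex[OF weak_koebe[unfolded Bex_def], folded koebe_const_def] by blast+

section \<open>Iterates that are injective on a fixed ball\<close>

lemma iterate_holomorphic: "(exp_map c ^^ n) holomorphic_on S"
proof (induction n)
  case (Suc n)
  then show ?case unfolding funpow.simps o_def by (subst exp_map_def) (intro holomorphic_intros)
qed (simp add: id_def)

lemma iterate_DERIV: "DERIV (exp_map c ^^ n) z :> deriv (exp_map c ^^ n) z"
  by (rule holomorphic_derivI[OF iterate_holomorphic open_UNIV UNIV_I])

lemma deriv_iterate_Suc:
  "deriv (exp_map c ^^ Suc n) z = exp ((exp_map c ^^ n) z) * deriv (exp_map c ^^ n) z"
proof -
  have "DERIV (exp_map c) ((exp_map c ^^ n) z) :> exp ((exp_map c ^^ n) z)"
    unfolding exp_map_def by (auto intro!: derivative_eq_intros)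
  then have "DERIV (exp_map c ^^ Suc n) z :> exp ((exp_map c ^^ n) z) * deriv (exp_map c ^^ n) z"
    unfolding funpow.simps by (rule DERIV_chain[OF _ iterate_DERIV])
  then show ?thesis by (rule DERIV_imp_deriv)
qed

lemma deriv_iterate_nonzero: "deriv (exp_map c ^^ n) z \<noteq> 0"
proof (induction n)
  case 0
  show ?case by (simp add: id_def)
next
  case (Suc n)
  then show ?case by (subst deriv_iterate_Suc) simp
qed

lemma inj_on_iterate_le:
  fixes f :: "'a \<Rightarrow> 'a"
  assumes "inj_on (f ^^ n) A" and "m \<le> n"
  shows "inj_on (f ^^ m) A"
proof -
  have "f ^^ n = (f ^^ (n - m)) \<circ> (f ^^ m)"
    using \<open>m \<le> n\<close> by (simp flip: funpow_add)
  then show ?thesis using assms(1) inj_on_imageI2 by metis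
qed

lemma radius_le_pi_of_inj_on_exp_map:
  assumes "inj_on (exp_map c) (ball w R)"
  shows "R \<le> pi"
proof (rule ccontr)
  assume "\<not> R \<le> pi"
  then have "w + pi * \<i> \<in> ball w R" "w - pi * \<i> \<in> ball w R"
    by (auto simp: dist_norm norm_mult)
  moreover have "exp_map c (w + pi * \<i>) = exp_map c (w - pi * \<i>)"
    by (simp add: exp_map_def exp_add exp_diff mult.commute)
  ultimately have "w + pi * \<i> = w - pi * \<i>" using assms by (meson inj_onD)
  then show False by simp
qed

text \<open>
  The \<open>n\<close>-th image of the ball contains a disc of radius proportional to the derivative, and one
  further application of the periodic map is still injective on it.
\<close>

lemma deriv_le_of_inj_on_iterate_Suc:
  assumes "0 < r" and "inj_on (exp_map c ^^ Suc n) (ball z r)"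
  shows "norm (deriv (exp_map c ^^ n) z) \<le> pi * koebe_const / r"
proof -
  have inj: "inj_on (exp_map c ^^ n) (ball z r)"
    using inj_on_iterate_le[OF assms(2)] by simp
  have "inj_on (exp_map c) ((exp_map c ^^ n) ` ball z r)"
    using assms(2) by (simp add: inj_on_imageI)
  then have "inj_on (exp_map c)
      (ball ((exp_map c ^^ n) z) (r * norm (deriv (exp_map c ^^ n) z) / koebe_const))"
    using koebe_covering[OF \<open>0 < r\<close> iterate_holomorphic inj] inj_on_subset by blast
  then have "r * norm (deriv (exp_map c ^^ n) z) / koebe_const \<le> pi"
    by (rule radius_le_pi_of_inj_on_exp_map)
  then show ?thesis using \<open>0 < r\<close> koebe_const_ge_1 by (simp add: field_simps)
qed

text \<open>
  The images of the half-size ball have uniformly bounded diameter. A sequence of iterates therefore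
  either returns to a bounded set at the centre infinitely often, and Montel's theorem applies to
  that subsequence, or it tends to infinity at the centre and hence uniformly on the ball.
\<close>

lemma fatou_set_if_iterates_inj_on:
  assumes "0 < r" and inj: "\<And>n. inj_on (exp_map c ^^ n) (ball z r)"
  shows "z \<in> fatou_set (exp_map c)"
proof -
  define U where "U = ball z (r/2)"
  define C where "C = koebe_const * r * (pi * koebe_const / r)"
  have spread: "norm (h y - h z) \<le> C" if "y \<in> U" "h \<in> range (\<lambda>n. exp_map c ^^ n)" for y h
  proof -
    obtain n where h: "h = exp_map c ^^ n" using \<open>h \<in> _\<close> by blast
    have "norm (h y - h z) \<le> koebe_const * r * norm (deriv h z)"
      unfolding h using that(1)
      by (intro koebe_growth \<open>0 < r\<close> iterate_holomorphic inj)
        (simp add: U_def dist_norm norm_minus_commute)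
    also have "\<dots> \<le> C" unfolding C_def h using \<open>0 < r\<close> koebe_const_ge_1
      by (intro mult_left_mono deriv_le_of_inj_on_iterate_Suc inj) auto
    finally show ?thesis .
  qed
  have "normal_family_on U (range (\<lambda>n. exp_map c ^^ n))"
    unfolding normal_family_on_def
  proof (intro allI impI)
    fix s :: "nat \<Rightarrow> complex \<Rightarrow> complex" assume s: "range s \<subseteq> range (\<lambda>n. exp_map c ^^ n)"
    have s_mem: "s n \<in> range (\<lambda>n. exp_map c ^^ n)" for n using s by blast
    show "\<exists>r. strict_mono r \<and>
        ((\<exists>g. g holomorphic_on U \<and>
            (\<forall>K. compact K \<and> K \<subseteq> U \<longrightarrow> uniform_limit K (s \<circ> r) g sequentially)) \<or>
         locally_uniformly_to_infinity U (s \<circ> r))"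
    proof (cases "\<exists>B. infinite {n. norm (s n z) \<le> B}")
      case True
      then obtain B where B: "infinite {n. norm (s n z) \<le> B}" by blast
      obtain r0 where r0: "strict_mono (r0 :: nat \<Rightarrow> nat)" "\<And>n. norm (s (r0 n) z) \<le> B"
        using infinite_enumerate[OF B] by auto
      define H where "H = {h. h holomorphic_on U \<and> (\<forall>y\<in>U. norm (h y) \<le> C + B)}"
      have "range (s \<circ> r0) \<subseteq> H"
      proof clarify
        fix n
        have "s (r0 n) holomorphic_on U" using s_mem[of "r0 n"] iterate_holomorphic by auto
        moreover have "norm (s (r0 n) y) \<le> C + B" if "y \<in> U" for y
          using norm_triangle_sub[of "s (r0 n) y" "s (r0 n) z"] spread[OF that s_mem[of "r0 n"]] r0(2)[of n]
          by linarith
        ultimately show "(s \<circ> r0) n \<in> H" by (simp add: H_def)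
      qed
      moreover have "open U" by (simp add: U_def)
      moreover have "h holomorphic_on U" if "h \<in> H" for h using that by (simp add: H_def)
      moreover have "\<exists>B. \<forall>h\<in>H. \<forall>y\<in>K. norm (h y) \<le> B" if "K \<subseteq> U" for K
        using that by (intro exI[of _ "C + B"]) (auto simp: H_def)
      ultimately obtain g r1 where "g holomorphic_on U" "strict_mono (r1 :: nat \<Rightarrow> nat)"
        "\<And>K. \<lbrakk>compact K; K \<subseteq> U\<rbrakk> \<Longrightarrow> uniform_limit K ((s \<circ> r0) \<circ> r1) g sequentially"
        using Montel[of U H "s \<circ> r0"] by metis
      then show ?thesis using strict_mono_o[OF r0(1), of r1] by (metis o_assoc)
    next
      case False
      have "locally_uniformly_to_infinity U s"
        unfolding locally_uniformly_to_infinity_def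
      proof (intro allI impI)
        fix K and B :: real assume K: "compact K \<and> K \<subseteq> U"
        have "finite {n. norm (s n z) \<le> B + C}" using False by blast
        then have "\<forall>\<^sub>F n in sequentially. norm (s n z) > B + C"
          by (simp add: flip: cofinite_eq_sequentially, simp add: eventually_cofinite not_less)
        then show "\<forall>\<^sub>F n in sequentially. \<forall>y\<in>K. norm (s n y) > B"
        proof (rule eventually_mono, intro ballI)
          fix n y assume "norm (s n z) > B + C" "y \<in> K"
          moreover have "norm (s n y - s n z) \<le> C" using K \<open>y \<in> K\<close> s_mem by (intro spread) auto
          ultimately show "norm (s n y) > B"
            using norm_triangle_sub[of "s n z" "s n y"] by (simp add: norm_minus_commute)
        qed
      qed
      then show ?thesis by (intro exI[of _ id]) (simp add: strict_mono_id)
    qed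
  qed
  then show ?thesis using \<open>0 < r\<close> unfolding fatou_set_def
    by (intro CollectI exI[of _ U]) (simp add: U_def)
qed

section \<open>Inverse branches of iterates\<close>

definition inverse_branch :: "complex \<Rightarrow> nat \<Rightarrow> complex \<Rightarrow> real \<Rightarrow> (complex \<Rightarrow> complex) \<Rightarrow> bool" where
  "inverse_branch c m z \<rho> \<phi> \<longleftrightarrow>
     \<phi> holomorphic_on ball ((exp_map c ^^ m) z) \<rho> \<and> \<phi> ((exp_map c ^^ m) z) = z \<and>
     (\<forall>x \<in> ball ((exp_map c ^^ m) z) \<rho>. (exp_map c ^^ m) (\<phi> x) = x)"

lemma inverse_branch_inj_on:
  "inverse_branch c m z \<rho> \<phi> \<Longrightarrow> inj_on \<phi> (ball ((exp_map c ^^ m) z) \<rho>)"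
  unfolding inverse_branch_def by (intro inj_on_inverseI[where g = "exp_map c ^^ m"]) simp

lemma inverse_branch_deriv:
  assumes "inverse_branch c m z \<rho> \<phi>" and "0 < \<rho>"
  shows "norm (deriv \<phi> ((exp_map c ^^ m) z)) = 1 / norm (deriv (exp_map c ^^ m) z)"
proof -
  define w where "w = (exp_map c ^^ m) z"
  note br = assms(1)[unfolded inverse_branch_def, folded w_def]
  have "DERIV \<phi> w :> deriv \<phi> w"
    using br \<open>0 < \<rho>\<close> by (intro holomorphic_derivI[of \<phi> "ball w \<rho>"]) auto
  moreover have "DERIV (exp_map c ^^ m) (\<phi> w) :> deriv (exp_map c ^^ m) z"
    using br iterate_DERIV by simp
  ultimately have "DERIV ((exp_map c ^^ m) \<circ> \<phi>) w :> deriv (exp_map c ^^ m) z * deriv \<phi> w"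
    by (intro DERIV_chain)
  moreover have "DERIV ((exp_map c ^^ m) \<circ> \<phi>) w :> 1"
    by (rule DERIV_cong_ev[THEN iffD2, OF refl _ refl DERIV_ident])
      (use br \<open>0 < \<rho>\<close> in \<open>auto simp: eventually_nhds intro!: exI[of _ "ball w \<rho>"]\<close>)
  ultimately have "deriv (exp_map c ^^ m) z * deriv \<phi> w = 1" by (rule DERIV_unique)
  then have "norm (deriv (exp_map c ^^ m) z) * norm (deriv \<phi> w) = 1" by (metis norm_mult norm_one)
  then show ?thesis unfolding w_def[symmetric] using deriv_iterate_nonzero[where c = c and n = m and z = z]
    by (simp add: field_simps)
qed

text \<open>
  The image of the branch contains a disc by Koebe covering, and \<open>f^m\<close> is injective on that image
  because the branch inverts it there.
\<close>

lemma inverse_branch_imp_inj_on: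
  assumes "inverse_branch c m z \<rho> \<phi>" and "0 < \<rho>"
  shows "inj_on (exp_map c ^^ m) (ball z (\<rho> / (koebe_const * norm (deriv (exp_map c ^^ m) z))))"
proof -
  define w where "w = (exp_map c ^^ m) z"
  note br = assms(1)[unfolded inverse_branch_def, folded w_def]
  have "inj_on \<phi> (ball w \<rho>)" using inverse_branch_inj_on[OF assms(1)] by (simp add: w_def)
  then have "ball (\<phi> w) (\<rho> * norm (deriv \<phi> w) / koebe_const) \<subseteq> \<phi> ` ball w \<rho>"
    using br \<open>0 < \<rho>\<close> by (intro koebe_covering) auto
  moreover have "\<rho> * norm (deriv \<phi> w) / koebe_const
      = \<rho> / (koebe_const * norm (deriv (exp_map c ^^ m) z))"
    using inverse_branch_deriv[OF assms] by (simp add: w_def)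
  moreover have "inj_on (exp_map c ^^ m) (\<phi> ` ball w \<rho>)"
    using br by (intro inj_onI) force
  ultimately show ?thesis using br by (metis inj_on_subset)
qed

lemma inverse_branch_0: "inverse_branch c 0 z \<rho> id"
  by (simp add: inverse_branch_def id_def)

text \<open>
  One more step back is a logarithm of \<open>\<phi> - c\<close>, which exists on the simply connected ball once \<open>\<phi>\<close>
  omits \<open>c\<close>; a constant multiple of \<open>2\<pi>\<i>\<close> adjusts its value at the centre.
\<close>

lemma inverse_branch_Suc:
  assumes br: "inverse_branch c m (exp_map c z) \<rho> \<phi>" and "0 < \<rho>"
    and omit: "c \<notin> \<phi> ` ball ((exp_map c ^^ m) (exp_map c z)) \<rho>"
  shows "\<exists>\<psi>. inverse_branch c (Suc m) z \<rho> \<psi>"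
proof -
  define w where "w = (exp_map c ^^ m) (exp_map c z)"
  have w: "(exp_map c ^^ Suc m) z = w" by (simp add: w_def funpow_swap1)
  note br = br[unfolded inverse_branch_def, folded w_def]
  obtain g where g: "g holomorphic_on ball w \<rho>" "\<And>x. x \<in> ball w \<rho> \<Longrightarrow> \<phi> x - c = exp (g x)"
  proof (rule contractible_imp_holomorphic_log)
    show "(\<lambda>x. \<phi> x - c) holomorphic_on ball w \<rho>" using br by (intro holomorphic_intros) auto
    show "\<phi> x - c \<noteq> 0" if "x \<in> ball w \<rho>" for x using omit that by (auto simp: w_def)
  qed (auto simp: convex_imp_contractible)
  have "exp (g w) = exp z" using g(2)[of w] br \<open>0 < \<rho>\<close> by (simp add: exp_map_def)
  then have shift: "exp (g x - g w + z) = exp (g x)" for x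
    by (simp add: exp_add exp_diff)
  have "(exp_map c ^^ Suc m) (g x - g w + z) = x" if x: "x \<in> ball w \<rho>" for x
  proof -
    have "exp_map c (g x - g w + z) = \<phi> x"
      using g(2)[OF x] shift[of x] by (simp add: exp_map_def flip: g(2)[OF x])
    then show ?thesis using br x by (simp add: funpow_Suc_right del: funpow.simps)
  qed
  then have "inverse_branch c (Suc m) z \<rho> (\<lambda>x. g x - g w + z)"
    unfolding inverse_branch_def w using g(1) by (auto intro!: holomorphic_intros)
  then show ?thesis by blast
qed

text \<open>
  Iterates have no critical points, so the two functions coincide near \<open>v\<close> by local
  injectivity, and then everywhere by the identity theorem.
\<close>

lemma local_inverses_agree:
  assumes "open S" "connected S" "\<phi> holomorphic_on S" "\<psi> holomorphic_on S"
    and inv: "\<And>x. x \<in> S \<Longrightarrow> (exp_map c ^^ m) (\<phi> x) = x" "\<And>x. x \<in> S \<Longrightarrow> (exp_map c ^^ m) (\<psi> x) = x"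
    and v: "v \<in> S" "\<phi> v = \<psi> v" and "x \<in> S"
  shows "\<phi> x = \<psi> x"
proof -
  obtain r where "r > 0" and inj: "inj_on (exp_map c ^^ m) (ball (\<phi> v) r)"
    using has_complex_derivative_locally_injective[OF iterate_holomorphic UNIV_I open_UNIV
        deriv_iterate_nonzero] by metis
  define T where "T = (S \<inter> \<phi> -` ball (\<phi> v) r) \<inter> (S \<inter> \<psi> -` ball (\<phi> v) r)"
  show ?thesis
  proof (rule analytic_continuation_open[of T S \<phi> \<psi>])
    show "open T" unfolding T_def using assms
      by (intro open_Int continuous_open_preimage holomorphic_on_imp_continuous_on) auto
    show "T \<noteq> {}" using v \<open>r > 0\<close> by (auto simp: T_def)
    show "\<phi> y = \<psi> y" if "y \<in> T" for y
    proof (rule inj_onD[OF inj])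
      show "(exp_map c ^^ m) (\<phi> y) = (exp_map c ^^ m) (\<psi> y)" using that inv by (simp add: T_def)
    qed (use that in \<open>auto simp: T_def\<close>)
    show "T \<subseteq> S" by (auto simp: T_def)
  qed fact+
qed

text \<open>
  A single distortion estimate from \<open>v\<close> does not reach \<open>w\<close>, which may be close to the
  boundary of the ball about \<open>v\<close>. Three estimates do: from \<open>v\<close> to the midpoint \<open>p\<close> with \<open>\<psi>\<close>, then with
  \<open>\<phi>\<close> from \<open>p\<close> to \<open>w\<close> via the midpoint \<open>q\<close> of the remaining segment, on discs of radius \<open>\<rho>/2\<close>
  inside the ball about \<open>w\<close>.
\<close>

lemma overlapping_balls_distortion:
  assumes "0 < \<rho>" and v: "v \<in> ball w \<rho>"
    and \<phi>: "\<phi> holomorphic_on ball w \<rho>" "inj_on \<phi> (ball w \<rho>)"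
    and \<psi>: "\<psi> holomorphic_on ball v \<rho>" "inj_on \<psi> (ball v \<rho>)"
    and agree: "\<And>x. x \<in> ball w \<rho> \<inter> ball v \<rho> \<Longrightarrow> \<phi> x = \<psi> x"
  shows "norm (\<phi> w - \<psi> v) \<le> 3 * koebe_const ^ 3 * \<rho> * norm (deriv \<psi> v)"
proof -
  define K where "K = koebe_const"
  define D where "D = norm (deriv \<psi> v)"
  have "1 \<le> K" by (simp add: K_def koebe_const_ge_1)
  have "0 \<le> D" by (simp add: D_def)
  define p where "p = (w + v) / 2"
  define q where "q = (p + w) / 2"
  have wv: "norm (w - v) < \<rho>" using v by (simp add: dist_norm)
  have "w - p = (w - v) / 2" "v - p = - ((w - v) / 2)" "w - q = (w - v) / 4" "p - q = - ((w - v) / 4)"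
    by (simp_all add: p_def q_def field_simps)
  then have d: "norm (w - p) < \<rho>/2" "norm (v - p) < \<rho>/2" "norm (w - q) < \<rho>/4" "norm (p - q) < \<rho>/4"
    using wv by (simp_all only: norm_divide norm_minus_cancel) simp_all
  have sub: "ball p (\<rho>/2) \<subseteq> ball w \<rho>" "ball q (\<rho>/2) \<subseteq> ball w \<rho>"
    using d by (auto simp: ball_subset_ball_iff dist_norm norm_minus_commute)
  have p: "p \<in> ball w \<rho> \<inter> ball v \<rho>" using d \<open>0 < \<rho>\<close> by (auto simp: dist_norm)
  have step: "norm (\<phi> b - \<phi> a) \<le> K * (\<rho>/2) * norm (deriv \<phi> a)" "norm (deriv \<phi> b) \<le> K * norm (deriv \<phi> a)"
    if "ball a (\<rho>/2) \<subseteq> ball w \<rho>" "norm (b - a) < \<rho>/4" for a b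
  proof -
    have *: "0 < \<rho>/2" "\<phi> holomorphic_on ball a (\<rho>/2)" "inj_on \<phi> (ball a (\<rho>/2))" "norm (b - a) \<le> \<rho>/2/2"
      using \<open>0 < \<rho>\<close> that \<phi> by (auto intro: holomorphic_on_subset inj_on_subset)
    show "norm (\<phi> b - \<phi> a) \<le> K * (\<rho>/2) * norm (deriv \<phi> a)" unfolding K_def by (rule koebe_growth[OF *])
    show "norm (deriv \<phi> b) \<le> K * norm (deriv \<phi> a)" unfolding K_def by (rule koebe_distortion[OF *])
  qed
  have "norm (\<psi> p - \<psi> v) \<le> K * \<rho> * D" "norm (deriv \<psi> p) \<le> K * D"
    unfolding K_def D_def using d(2)
    by (auto intro!: koebe_growth[OF \<open>0 < \<rho>\<close> \<psi>] koebe_distortion[OF \<open>0 < \<rho>\<close> \<psi>] simp: norm_minus_commute)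
  moreover have "\<phi> p = \<psi> p" using agree p by blast
  moreover have "deriv \<phi> p = deriv \<psi> p"
    by (rule complex_derivative_transform_within_open[of _ "ball w \<rho> \<inter> ball v \<rho>"])
      (use agree p \<phi> \<psi> in \<open>auto intro: holomorphic_on_subset\<close>)
  ultimately have 1: "norm (\<phi> p - \<psi> v) \<le> K * \<rho> * D" "norm (deriv \<phi> p) \<le> K * D" by simp_all
  have "norm (deriv \<phi> q) \<le> K * norm (deriv \<phi> p)"
    using d(4) by (intro step(2) sub) (simp add: norm_minus_commute)
  also have "\<dots> \<le> K * (K * D)" using 1(2) \<open>1 \<le> K\<close> by (intro mult_left_mono) auto
  finally have 2: "norm (deriv \<phi> q) \<le> K * (K * D)" .
  have "norm (\<phi> q - \<phi> p) \<le> K * (\<rho>/2) * norm (deriv \<phi> p)"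
    using d(4) by (intro step(1) sub) (simp add: norm_minus_commute)
  also have "\<dots> \<le> K * (\<rho>/2) * (K * D)" using 1(2) \<open>1 \<le> K\<close> \<open>0 < \<rho>\<close> by (intro mult_left_mono) auto
  finally have 3: "norm (\<phi> q - \<phi> p) \<le> K * (\<rho>/2) * (K * D)" .
  have "norm (\<phi> w - \<phi> q) \<le> K * (\<rho>/2) * norm (deriv \<phi> q)"
    using d(3) by (intro step(1) sub) 
  also have "\<dots> \<le> K * (\<rho>/2) * (K * (K * D))" using 2 \<open>1 \<le> K\<close> \<open>0 < \<rho>\<close> by (intro mult_left_mono) auto
  finally have 4: "norm (\<phi> w - \<phi> q) \<le> K * (\<rho>/2) * (K * (K * D))" .
  define E where "E = \<rho> * D"
  have "0 \<le> E" using \<open>0 < \<rho>\<close> \<open>0 \<le> D\<close> by (simp add: E_def)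
  have "norm (\<phi> w - \<psi> v) \<le> norm (\<phi> w - \<phi> q) + norm (\<phi> q - \<phi> p) + norm (\<phi> p - \<psi> v)"
    using norm_triangle_ineq[of "\<phi> w - \<phi> q" "\<phi> q - \<phi> p"]
      norm_triangle_ineq[of "\<phi> w - \<phi> p" "\<phi> p - \<psi> v"] by simp
  also have "\<dots> \<le> (K ^ 3 / 2 + K\<^sup>2 / 2 + K) * E"
    using 1(1) 3 4 by (simp add: E_def power2_eq_square power3_eq_cube algebra_simps)
  also have "\<dots> \<le> (K ^ 3 + K ^ 3 + K ^ 3) * E"
  proof (intro mult_right_mono add_mono)
    have "K ^ 2 \<le> K ^ 3" "K ^ 1 \<le> K ^ 3" using \<open>1 \<le> K\<close> by (intro power_increasing; simp)+
    then show "K ^ 2 / 2 \<le> K ^ 3" "K \<le> K ^ 3" "K ^ 3 / 2 \<le> K ^ 3" using \<open>1 \<le> K\<close> by auto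
  qed fact
  finally show ?thesis by (simp add: K_def D_def E_def mult_ac)
qed

section \<open>The postsingular set\<close>

lemma iterate_singular_value_in_postsingular: "0 < n \<Longrightarrow> (exp_map c ^^ n) c \<in> postsingular_set c"
  unfolding postsingular_set_def by (rule subsetD[OF closure_subset]) blast

lemma exp_map_in_postsingular:
  assumes "z \<in> postsingular_set c"
  shows "exp_map c z \<in> postsingular_set c"
proof -
  define orb where "orb = (\<Union>n\<in>{0<..}. {(exp_map c ^^ n) c})"
  have "exp_map c ` orb \<subseteq> orb"
  proof
    fix y assume "y \<in> exp_map c ` orb"
    then obtain n where "0 < n" "y = exp_map c ((exp_map c ^^ n) c)" by (auto simp: orb_def)
    then have "y = (exp_map c ^^ Suc n) c" by simp
    then show "y \<in> orb" unfolding orb_def by blast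
  qed
  moreover have "continuous_on (closure orb) (exp_map c)"
    unfolding exp_map_def by (intro continuous_intros)
  ultimately have "exp_map c ` closure orb \<subseteq> closure orb"
    by (intro image_closure_subset) (use closure_subset in auto)
  then show ?thesis using assms unfolding postsingular_set_def orb_def by blast
qed

lemma deriv_exp_map: "deriv (exp_map c) z = exp_map c z - c"
  using deriv_iterate_Suc[where n = 0 and c = c and z = z] by (simp add: exp_map_def id_def o_def)

lemma norm_deriv_iterate_ge:
  assumes "\<And>n. 0 < n \<Longrightarrow> \<delta> \<le> norm ((exp_map c ^^ n) z - c)" and "0 \<le> \<delta>"
  shows "\<delta> ^ m \<le> norm (deriv (exp_map c ^^ m) z)"
proof (induction m)
  case (Suc m)
  have "\<delta> \<le> norm (exp ((exp_map c ^^ m) z))"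
    using assms(1)[of "Suc m"] by (simp add: exp_map_def)
  then have "\<delta> * \<delta> ^ m \<le> norm (exp ((exp_map c ^^ m) z)) * norm (deriv (exp_map c ^^ m) z)"
    using Suc.IH \<open>0 \<le> \<delta>\<close> by (intro mult_mono) auto
  then show ?case by (subst deriv_iterate_Suc) (simp add: norm_mult)
qed (simp add: id_def)

section \<open>Pullbacks along the postsingular set\<close>

definition pullback_meets_singular_value :: "complex \<Rightarrow> nat \<Rightarrow> real \<Rightarrow> bool" where
  "pullback_meets_singular_value c m \<rho> \<longleftrightarrow>
     (\<exists>z\<in>postsingular_set c. \<exists>\<phi>. inverse_branch c m z \<rho> \<phi> \<and> c \<in> \<phi> ` ball ((exp_map c ^^ m) z) \<rho>)"

text \<open>
  The assumption speaks of all points of the postsingular set, so the induction may build the branch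
  from the far end: first the one for the image point \<open>f z\<close>, then one more logarithm.
\<close>

lemma inverse_branch_exists:
  assumes "0 < \<rho>"
  shows "\<lbrakk>\<And>i. i < m \<Longrightarrow> \<not> pullback_meets_singular_value c i \<rho>; z \<in> postsingular_set c\<rbrakk>
    \<Longrightarrow> \<exists>\<phi>. inverse_branch c m z \<rho> \<phi>"
proof (induction m arbitrary: z)
  case 0
  show ?case using inverse_branch_0 by blast
next
  case (Suc m)
  have fz: "exp_map c z \<in> postsingular_set c" using Suc.prems(2) by (rule exp_map_in_postsingular)
  then obtain \<phi> where \<phi>: "inverse_branch c m (exp_map c z) \<rho> \<phi>" using Suc.IH Suc.prems(1) by (meson less_Suc_eq)
  moreover have "c \<notin> \<phi> ` ball ((exp_map c ^^ m) (exp_map c z)) \<rho>"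
    using Suc.prems(1)[of m] \<phi> fz unfolding pullback_meets_singular_value_def by blast
  ultimately show ?case using inverse_branch_Suc \<open>0 < \<rho>\<close> by blast
qed

text \<open>
  At the first time \<open>m\<close> at which a pullback of radius \<open>\<rho>\<close> meets \<open>c\<close>, the pullback of the
  ball of the same radius about \<open>f^m c\<close> along the orbit of \<open>c\<close> is still univalent, because the orbit from \<open>f c\<close>
  on lies in the postsingular set and pullbacks by at most \<open>m - 1\<close> steps do not meet \<open>c\<close>. The two
  overlapping branches then compare \<open>\<delta>\<close>, a lower bound for \<open>|z - c|\<close>, with \<open>\<rho> / |(f^m)' c|\<close>. The second conclusion
  no longer depends on \<open>\<rho>\<close>, which is what allows \<open>\<rho>\<close> to be chosen after a bound on \<open>m\<close>.
\<close>

lemma first_meeting_time: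
  assumes "0 < \<rho>" "0 < \<delta>" "\<rho> \<le> \<delta>" and \<delta>: "\<And>z. z \<in> postsingular_set c \<Longrightarrow> \<delta> \<le> norm (z - c)"
    and meets: "pullback_meets_singular_value c m \<rho>"
    and first: "\<And>i. i < m \<Longrightarrow> \<not> pullback_meets_singular_value c i \<rho>"
  shows "\<delta> * norm (deriv (exp_map c ^^ m) c) \<le> 3 * koebe_const ^ 3 * \<rho>"
    and "inj_on (exp_map c ^^ m) (ball c (\<delta> / (3 * koebe_const ^ 4)))"
proof -
  obtain z \<phi> where z: "z \<in> postsingular_set c" and \<phi>: "inverse_branch c m z \<rho> \<phi>"
    and meet: "c \<in> \<phi> ` ball ((exp_map c ^^ m) z) \<rho>"
    using meets unfolding pullback_meets_singular_value_def by blast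
  define w where "w = (exp_map c ^^ m) z"
  define v where "v = (exp_map c ^^ m) c"
  note br\<phi> = \<phi>[unfolded inverse_branch_def, folded w_def]
  obtain u where u: "u \<in> ball w \<rho>" "c = \<phi> u" using meet by (auto simp: w_def)
  then have "u = v" using br\<phi> by (simp add: v_def)
  then have v: "v \<in> ball w \<rho>" "\<phi> v = c" using u by simp_all
  have "m \<noteq> 0"
  proof
    assume "m = 0"
    then have "norm (z - c) < \<rho>" using v by (simp add: w_def v_def dist_norm)
    then show False using \<delta>[OF z] \<open>\<rho> \<le> \<delta>\<close> by linarith
  qed
  then obtain k where k: "m = Suc k" by (cases m) auto
  have fc: "exp_map c c \<in> postsingular_set c"
    using iterate_singular_value_in_postsingular[where n = 1 and c = c] by simp
  obtain \<theta> where \<theta>: "inverse_branch c k (exp_map c c) \<rho> \<theta>"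
    using inverse_branch_exists[OF \<open>0 < \<rho>\<close> _ fc, of k] first k by auto
  moreover have "c \<notin> \<theta> ` ball ((exp_map c ^^ k) (exp_map c c)) \<rho>"
    using first[of k] k \<theta> fc unfolding pullback_meets_singular_value_def by blast
  ultimately obtain \<psi> where \<psi>: "inverse_branch c m c \<rho> \<psi>"
    using inverse_branch_Suc \<open>0 < \<rho>\<close> k by blast
  note br\<psi> = \<psi>[unfolded inverse_branch_def, folded v_def]
  have agree: "\<phi> x = \<psi> x" if "x \<in> ball w \<rho> \<inter> ball v \<rho>" for x
  proof (rule local_inverses_agree[where \<phi> = \<phi> and \<psi> = \<psi> and S = "ball w \<rho> \<inter> ball v \<rho>" and c = c and m = m and v = v])
    show "connected (ball w \<rho> \<inter> ball v \<rho>)" by (intro convex_connected convex_Int convex_ball)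
  qed (use that v br\<phi> br\<psi> \<open>0 < \<rho>\<close> in \<open>auto intro: holomorphic_on_subset\<close>)
  have "norm (\<phi> w - \<psi> v) \<le> 3 * koebe_const ^ 3 * \<rho> * norm (deriv \<psi> v)"
    using \<open>0 < \<rho>\<close> v(1) br\<phi> br\<psi> inverse_branch_inj_on[OF \<phi>] inverse_branch_inj_on[OF \<psi>] agree
    by (intro overlapping_balls_distortion) (auto simp: w_def v_def)
  then have "\<delta> \<le> 3 * koebe_const ^ 3 * \<rho> * norm (deriv \<psi> v)"
    using \<delta>[OF z] br\<phi> br\<psi> by simp
  moreover have "norm (deriv \<psi> v) = 1 / norm (deriv (exp_map c ^^ m) c)"
    using inverse_branch_deriv[OF \<psi> \<open>0 < \<rho>\<close>] by (simp add: v_def)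
  moreover have pos: "0 < norm (deriv (exp_map c ^^ m) c)" using deriv_iterate_nonzero by simp
  ultimately show 1: "\<delta> * norm (deriv (exp_map c ^^ m) c) \<le> 3 * koebe_const ^ 3 * \<rho>"
    by (simp add: field_simps)
  have K: "0 < koebe_const" using koebe_const_ge_1 by simp
  have "\<delta> / (3 * koebe_const ^ 4) \<le> \<rho> / (koebe_const * norm (deriv (exp_map c ^^ m) c))"
  proof -
    have "koebe_const * (\<delta> * norm (deriv (exp_map c ^^ m) c)) \<le> koebe_const * (3 * koebe_const ^ 3 * \<rho>)"
      using 1 K by (intro mult_left_mono) auto
    then show ?thesis using K pos by (simp add: field_simps power_numeral_reduce)
  qed
  then show "inj_on (exp_map c ^^ m) (ball c (\<delta> / (3 * koebe_const ^ 4)))"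
    using inverse_branch_imp_inj_on[OF \<psi> \<open>0 < \<rho>\<close>] by (meson inj_on_subset subset_ball)
qed

text \<open>
  Some iterate \<open>f^J\<close> fails to be injective on the disc of \<open>first_meeting_time\<close>, so a first
  meeting time is at most \<open>J\<close>, however small \<open>\<rho>\<close> is. The orbit of \<open>c\<close> stays \<open>\<delta>\<close>-away from \<open>c\<close>, hence
  \<open>(f^m)' c\<close> is bounded below for \<open>m \<le> J\<close>, and the derivative estimate there fails for small \<open>\<rho>\<close>.
\<close>

lemma no_pullback_meets_singular_value:
  assumes "c \<notin> fatou_set (exp_map c)" "0 < \<delta>"
    and \<delta>: "\<And>z. z \<in> postsingular_set c \<Longrightarrow> \<delta> \<le> norm (z - c)"
  shows "\<exists>\<rho>>0. \<forall>m. \<not> pullback_meets_singular_value c m \<rho>"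
proof (rule ccontr)
  assume contra: "\<not> ?thesis"
  define \<kappa> where "\<kappa> = \<delta> / (3 * koebe_const ^ 4)"
  have "0 < \<kappa>" using \<open>0 < \<delta>\<close> koebe_const_ge_1 by (simp add: \<kappa>_def)
  then obtain J where J: "\<not> inj_on (exp_map c ^^ J) (ball c \<kappa>)"
    using assms(1) fatou_set_if_iterates_inj_on by blast
  \<comment> \<open>A lower bound for \<open>\<delta> ^ m\<close> for all \<open>m \<le> J\<close>, whether or not \<open>\<delta> < 1\<close>.\<close>
  define \<mu> where "\<mu> = min 1 \<delta> ^ J"
  have "0 < \<mu>" using \<open>0 < \<delta>\<close> by (simp add: \<mu>_def)
  define \<rho> where "\<rho> = min \<delta> (\<delta> * \<mu> / (6 * koebe_const ^ 3))"
  have "0 < koebe_const" using koebe_const_ge_1 by linarith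
  then have "0 < \<delta> * \<mu> / (6 * koebe_const ^ 3)" using \<open>0 < \<delta>\<close> \<open>0 < \<mu>\<close> by simp
  then have "0 < \<rho>" "\<rho> \<le> \<delta>" using \<open>0 < \<delta>\<close> by (simp_all add: \<rho>_def)
  define m where "m = (LEAST m. pullback_meets_singular_value c m \<rho>)"
  have meets: "pullback_meets_singular_value c m \<rho>"
  proof -
    have "\<exists>m. pullback_meets_singular_value c m \<rho>" using contra \<open>0 < \<rho>\<close> by blast
    then show ?thesis unfolding m_def by (rule LeastI_ex)
  qed
  have first: "\<not> pullback_meets_singular_value c i \<rho>" if "i < m" for i
    using not_less_Least that unfolding m_def by blast
  note * = first_meeting_time[OF \<open>0 < \<rho>\<close> \<open>0 < \<delta>\<close> \<open>\<rho> \<le> \<delta>\<close> \<delta> meets first]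
  have "m \<le> J" using J *(2) inj_on_iterate_le unfolding \<kappa>_def by (meson linear)
  have "\<mu> \<le> min 1 \<delta> ^ m" unfolding \<mu>_def using \<open>m \<le> J\<close> \<open>0 < \<delta>\<close> by (intro power_decreasing) auto
  also have "\<dots> \<le> norm (deriv (exp_map c ^^ m) c)"
    using \<delta> iterate_singular_value_in_postsingular \<open>0 < \<delta>\<close>
    by (intro norm_deriv_iterate_ge) (auto intro: min.coboundedI2)
  finally have "\<delta> * \<mu> \<le> \<delta> * norm (deriv (exp_map c ^^ m) c)" using \<open>0 < \<delta>\<close> by simp
  also have "\<dots> \<le> 3 * koebe_const ^ 3 * \<rho>" by (rule *(1))
  also have "\<dots> \<le> 3 * koebe_const ^ 3 * (\<delta> * \<mu> / (6 * koebe_const ^ 3))"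
    using \<open>0 < koebe_const\<close> by (intro mult_left_mono) (simp_all add: \<rho>_def)
  also have "\<dots> = \<delta> * \<mu> / 2" using \<open>0 < koebe_const\<close> by simp
  finally show False using \<open>0 < \<delta>\<close> \<open>0 < \<mu>\<close> by (simp add: mult_pos_pos)
qed

section \<open>Expansion on the postsingular set\<close>

text \<open>
  Injectivity of all iterates near a postsingular point transfers to \<open>c\<close> through an iterate that
  carries a neighbourhood of \<open>c\<close> injectively into the given ball.
\<close>

lemma fatou_set_if_iterates_inj_on_near_postsingular:
  assumes "y \<in> postsingular_set c" "0 < r" and inj: "\<And>n. inj_on (exp_map c ^^ n) (ball y r)"
  shows "c \<in> fatou_set (exp_map c)"
proof -
  obtain N where N: "(exp_map c ^^ N) c \<in> ball y r"
    using closure_approachableD[OF assms(1)[unfolded postsingular_set_def] \<open>0 < r\<close>] by auto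
  obtain e where "e > 0" and inj_e: "inj_on (exp_map c ^^ N) (ball c e)"
    using has_complex_derivative_locally_injective[OF iterate_holomorphic UNIV_I open_UNIV
        deriv_iterate_nonzero] by metis
  have "open ((exp_map c ^^ N) -` ball y r)"
    using iterate_holomorphic holomorphic_on_imp_continuous_on
    by (intro open_vimage open_ball) blast
  then obtain d where "d > 0" "ball c d \<subseteq> (exp_map c ^^ N) -` ball y r"
    using N unfolding open_contains_ball by blast
  then have d: "(exp_map c ^^ N) ` ball c (min d e) \<subseteq> ball y r" by auto
  have "inj_on (exp_map c ^^ n) (ball c (min d e))" for n
  proof -
    have "inj_on ((exp_map c ^^ n) \<circ> (exp_map c ^^ N)) (ball c (min d e))"
      using inj_e inj[of n] d by (intro comp_inj_on) (auto intro: inj_on_subset)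
    then have "inj_on (exp_map c ^^ (n + N)) (ball c (min d e))" by (simp add: funpow_add)
    then show ?thesis using inj_on_iterate_le le_add1 by blast
  qed
  then show ?thesis using \<open>d > 0\<close> \<open>e > 0\<close> by (intro fatou_set_if_iterates_inj_on[of "min d e"]) auto
qed

text \<open>
  The points \<open>z\<close> themselves need not stay bounded, but their images \<open>y = f z\<close> do: \<open>y - c = f' z\<close>, and
  this derivative is bounded because \<open>f^2\<close> is injective on a ball of fixed radius about \<open>z\<close>.
\<close>

theorem corollaryA:
  fixes c :: complex
  assumes "c \<in> julia_set (exp_map c)"
    and "c \<notin> postsingular_set c"
  shows "euclidean_hyperbolic_on (exp_map c) (postsingular_set c)"
proof (rule ccontr)
  assume not_hyp: "\<not> ?thesis"
  define K where "K = koebe_const"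
  have "1 \<le> K" by (simp add: K_def koebe_const_ge_1)
  have closed: "closed (postsingular_set c)" by (simp add: postsingular_set_def)
  have julia: "c \<notin> fatou_set (exp_map c)" using assms(1) by (simp add: julia_set_def)
  obtain \<delta> where "0 < \<delta>" and \<delta>: "\<And>z. z \<in> postsingular_set c \<Longrightarrow> \<delta> \<le> norm (z - c)"
    using separate_point_closed[OF closed assms(2)] by (metis dist_norm norm_minus_commute)
  obtain \<rho> where "0 < \<rho>" and \<rho>: "\<And>m. \<not> pullback_meets_singular_value c m \<rho>"
    using no_pullback_meets_singular_value[OF julia \<open>0 < \<delta>\<close> \<delta>] by blast
  \<comment> \<open>The Koebe radius about \<open>z\<close> of an inverse branch on a ball of radius \<open>\<rho>\<close> when the derivative is at most \<open>2\<close>.\<close>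
  define r where "r = \<rho> / (K * 2)"
  have "0 < r" using \<open>0 < \<rho>\<close> \<open>1 \<le> K\<close> by (simp add: r_def)
  \<comment> \<open>The Koebe radius about \<open>f z\<close> of the image of a ball of radius \<open>r\<close>, as \<open>|f' z| \<ge> \<delta>\<close>.\<close>
  define s where "s = r * \<delta> / K"
  have "0 < s" using \<open>0 < r\<close> \<open>0 < \<delta>\<close> \<open>1 \<le> K\<close> by (simp add: s_def)
  have "\<exists>y. y \<in> postsingular_set c \<inter> cball c (pi * K / r) \<and> inj_on (exp_map c ^^ n) (ball y s)" for n
  proof -
    obtain k z where k: "k > Suc n" and z: "z \<in> postsingular_set c"
      and small: "norm (deriv (exp_map c ^^ k) z) \<le> 2"
      using not_hyp unfolding euclidean_hyperbolic_on_def
      by (metis not_le one_less_numeral_iff semiring_norm(76))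
    obtain \<phi> where "inverse_branch c k z \<rho> \<phi>"
      using inverse_branch_exists[OF \<open>0 < \<rho>\<close> \<rho> z] by blast
    then have "inj_on (exp_map c ^^ k) (ball z (\<rho> / (K * norm (deriv (exp_map c ^^ k) z))))"
      unfolding K_def using inverse_branch_imp_inj_on \<open>0 < \<rho>\<close> by blast
    moreover have "r \<le> \<rho> / (K * norm (deriv (exp_map c ^^ k) z))"
      unfolding r_def using small \<open>0 < \<rho>\<close> \<open>1 \<le> K\<close> deriv_iterate_nonzero
      by (intro divide_left_mono mult_left_mono mult_pos_pos) auto
    ultimately have inj_k: "inj_on (exp_map c ^^ k) (ball z r)"
      by (meson inj_on_subset subset_ball)
    have inj_z: "inj_on (exp_map c ^^ m) (ball z r)" if "m \<le> k" for m
      using inj_on_iterate_le[OF inj_k that] .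
    define y where "y = exp_map c z"
    have y: "y \<in> postsingular_set c" unfolding y_def by (rule exp_map_in_postsingular[OF z])
    have dz: "deriv (exp_map c ^^ 1) z = y - c" by (simp add: deriv_exp_map y_def)
    have "norm (y - c) \<le> pi * K / r"
      using deriv_le_of_inj_on_iterate_Suc[OF \<open>0 < r\<close>, of 1 c z] inj_z[of 2] k dz
      by (simp add: K_def numeral_2_eq_2)
    moreover have "inj_on (exp_map c ^^ n) (ball y s)"
    proof -
      have "inj_on (exp_map c ^^ n \<circ> exp_map c) (ball z r)"
        using inj_z[of "Suc n"] k by (simp add: funpow_Suc_right del: funpow.simps)
      then have "inj_on (exp_map c ^^ n) (exp_map c ` ball z r)" by (rule inj_on_imageI)
      moreover have "ball y (r * norm (y - c) / K) \<subseteq> exp_map c ` ball z r"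
        using koebe_covering[OF \<open>0 < r\<close> iterate_holomorphic inj_z[of 1]] k dz
        by (simp add: K_def y_def)
      moreover have "s \<le> r * norm (y - c) / K"
        unfolding s_def using \<delta>[OF y] \<open>0 < r\<close> \<open>1 \<le> K\<close> by (intro divide_right_mono mult_left_mono) auto
      ultimately show ?thesis by (meson inj_on_subset order_trans subset_ball)
    qed
    ultimately show ?thesis using y by (auto simp: dist_norm norm_minus_commute)
  qed
  then obtain y where y: "\<And>n. y n \<in> postsingular_set c \<inter> cball c (pi * K / r)"
    and inj_y: "\<And>n. inj_on (exp_map c ^^ n) (ball (y n) s)"
    by metis
  have "compact (postsingular_set c \<inter> cball c (pi * K / r))"
    using closed by (simp add: closed_Int_compact)
  then obtain l \<sigma> where l: "l \<in> postsingular_set c" and \<sigma>: "strict_mono (\<sigma> :: nat \<Rightarrow> nat)"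
    and lim: "(y \<circ> \<sigma>) \<longlonglongrightarrow> l"
    using y unfolding compact_def by (metis IntD1)
  have "inj_on (exp_map c ^^ n) (ball l (s/2))" for n
  proof -
    have "\<forall>\<^sub>F i in sequentially. dist (y (\<sigma> i)) l < s/2"
      using tendstoD[OF lim, of "s/2"] \<open>0 < s\<close> by simp
    then obtain i where i: "n \<le> i" "dist (y (\<sigma> i)) l < s/2"
      unfolding eventually_sequentially by (meson linear order_refl order_trans)
    have "ball l (s/2) \<subseteq> ball (y (\<sigma> i)) s"
      using i(2) by (simp add: ball_subset_ball_iff dist_commute)
    moreover have "n \<le> \<sigma> i" using i(1) seq_suble[OF \<sigma>, of i] by simp
    ultimately show ?thesis using inj_y[of "\<sigma> i"] by (meson inj_on_iterate_le inj_on_subset)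
  qed
  then have "c \<in> fatou_set (exp_map c)"
    using \<open>0 < s\<close> by (intro fatou_set_if_iterates_inj_on_near_postsingular[OF l, of "s/2"]) auto
  then show False using julia by contradiction
qed

end
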